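(* For any $a,b>0$ and $v\in[0,1]$ we have $$L_v(a,b)=(1-v)\,L\big(a\sharp_v b,a\big)+v\,L\big(a\sharp_v b,b\big)=L\big(a\sharp_v b,a\big)\nabla_v L\big(a\sharp_v b,b\big)$$ and $$I_v(a,b)=\Big(I\big(a\nabla_v b,a\big)\Big)^{1-v}\Big(I\big(a\nabla_v b,b\big)\Big)^{v}=I\big(a\nabla_v b,a\big)\sharp_v I\big(a\nabla_v b,b\big).$$
   Context: For $a,b>0$ and $v\in[0,1]$: $a\nabla_v b=(1-v)a+vb$ (weighted arithmetic mean) and $a\sharp_v b=a^{1-v}b^v$ (weighted geometric mean). The logarithmic mean is $L(a,b)=\frac{b-a}{\log b-\log a}$ for $a\ne b$, $L(a,a)=a$. The identric mean is $I(a,b)=e^{-1}\big(b^b/a^a\big)^{1/(b-a)}$ for $a\neq b$, $I(a,a)=a$. The weighted logarithmic mean $L_v$ and the weighted identric mean $I_v$ are defined, for $a\ne b$ and $v\in(0,1)$, by $$L_v(a,b)=\frac{1}{\log a-\log b}\left(\frac{1-v}{v}\big(a-a^{1-v}b^v\big)+\frac{v}{1-v}\big(a^{1-v}b^v-b\big)\right),$$ $$I_v(a,b)=\frac1e\,\big(a\nabla_v b\big)^{\frac{(1-2v)(a\nabla_v b)}{v(1-v)(b-a)}}\left(\frac{b^{\frac{vb}{1-v}}}{a^{\frac{(1-v)a}{v}}}\right)^{\frac1{b-a}},$$ with the limit values $L_0(a,b)=I_0(a,b)=a$, $L_1(a,b)=I_1(a,b)=b$, and $L_v(a,a)=I_v(a,a)=a$.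 *)

theory Defs
  imports Complex_Main
begin

(* All means below are meaningful for a, b > 0 and, when weighted, 0 <= v <= 1;
   values outside this range are irrelevant artefacts of totality. *)

definition weighted_arith_mean :: "real \<Rightarrow> real \<Rightarrow> real \<Rightarrow> real" where
  "weighted_arith_mean v a b = (1 - v) * a + v * b"

definition weighted_geom_mean :: "real \<Rightarrow> real \<Rightarrow> real \<Rightarrow> real" where
  "weighted_geom_mean v a b = a powr (1 - v) * b powr v"

definition log_mean :: "real \<Rightarrow> real \<Rightarrow> real" where
  "log_mean a b = (if a = b then a else (b - a) / (ln b - ln a))"

definition identric_mean :: "real \<Rightarrow> real \<Rightarrow> real" where
  "identric_mean a b =
    (if a = b then a else exp (-1) * ((b powr b) / (a powr a)) powr (1 / (b - a)))"

(* The closed formulas of the two weighted means divide by v, 1 - v and by ln a - ln b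
   or b - a, so the limit values at v = 0, v = 1 and a = b are explicit cases. *)

definition weighted_log_mean :: "real \<Rightarrow> real \<Rightarrow> real \<Rightarrow> real" where
  "weighted_log_mean v a b =
    (if a = b then a
     else if v = 0 then a
     else if v = 1 then b
     else 1 / (ln a - ln b) *
       ((1 - v) / v * (a - a powr (1 - v) * b powr v)
        + v / (1 - v) * (a powr (1 - v) * b powr v - b)))"

definition weighted_identric_mean :: "real \<Rightarrow> real \<Rightarrow> real \<Rightarrow> real" where
  "weighted_identric_mean v a b =
    (if a = b then a
     else if v = 0 then a
     else if v = 1 then b
     else 1 / exp 1 *
       weighted_arith_mean v a b powr
         ((1 - 2 * v) * weighted_arith_mean v a b / (v * (1 - v) * (b - a))) *
       ((b powr (v * b / (1 - v))) / (a powr ((1 - v) * a / v))) powr (1 / (b - a)))"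

end

theory Submission
  imports Defs
begin

text \<open>With \<open>g\<close> the weighted geometric and \<open>m\<close> the weighted arithmetic mean of \<open>a\<close> and \<open>b\<close>,
  the differences \<open>ln g - ln a\<close>, \<open>ln g - ln b\<close> and \<open>m - a\<close>, \<open>m - b\<close> are the multiples
  \<open>v\<close> and \<open>- (1 - v)\<close> of \<open>ln b - ln a\<close> and \<open>b - a\<close>, respectively. Hence the denominators of the
  unweighted means combine to those of the weighted ones; for the identric means this happens
  after taking logarithms, where \<open>(1 - v) / v - v / (1 - v) = (1 - 2 * v) / (v * (1 - v))\<close>
  gives the exponent of \<open>m\<close>.\<close>

lemma weighted_arith_mean_pos:
  assumes "a > 0" "b > 0" "0 \<le> v" "v \<le> 1"
  shows "weighted_arith_mean v a b > 0"
  \<comment> \<open>The library bound is an upper one, so it is applied to \<open>- a\<close> and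
    \<open>- b\<close> with bound \<open>0\<close>.\<close>
  using assms convex_bound_lt [of "- a" 0 "- b" "1 - v" v]
  by (simp add: weighted_arith_mean_def)

lemma weighted_arith_mean_minus:
  "weighted_arith_mean v a b - a = v * (b - a)"
  "weighted_arith_mean v a b - b = - (1 - v) * (b - a)"
  by (simp_all add: weighted_arith_mean_def algebra_simps)

lemma ln_weighted_geom_mean:
  assumes "a > 0" "b > 0"
  shows "ln (weighted_geom_mean v a b) = (1 - v) * ln a + v * ln b"
  using assms by (simp add: weighted_geom_mean_def ln_mult ln_powr)

lemma identric_mean_pos:
  assumes "a > 0" "b > 0"
  shows "identric_mean a b > 0"
  using assms by (simp add: identric_mean_def)

text \<open>Writing powers of the identric mean through \<open>exp\<close> turns the product of two
  such powers into a sum of exponents, which reduces the weighted identity to a rational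
  one.\<close>

lemma identric_mean_powr:
  assumes "a > 0" "b > 0" "a \<noteq> b"
  shows "identric_mean a b powr t = exp (t * ((b * ln b - a * ln a) / (b - a) - 1))"
proof -
  have "identric_mean a b = exp (- 1 + 1 / (b - a) * (b * ln b - a * ln a))"
    unfolding exp_add using assms by (simp add: identric_mean_def powr_def ln_div)
  then show ?thesis
    by (simp add: exp_powr_real mult.commute)
qed

lemma weighted_log_mean_eq:
  assumes "a > 0" "b > 0" "0 \<le> v" "v \<le> 1"
  shows "weighted_log_mean v a b =
    (1 - v) * log_mean (weighted_geom_mean v a b) a
    + v * log_mean (weighted_geom_mean v a b) b"
proof -
  consider "a = b \<or> v = 0 \<or> v = 1" | "a \<noteq> b" "0 < v" "v < 1"
    using assms by linarith
  then show ?thesis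
  proof cases
    case 1
    \<comment> \<open>The geometric mean collapses to \<open>a\<close> if \<open>v = 0\<close>, to
      \<open>b\<close> if \<open>v = 1\<close>, and to the common value, by \<open>powr_add\<close>,
      if \<open>a = b\<close>. Every \<open>log_mean\<close> with nonzero weight is then on the
      diagonal.\<close>
    then show ?thesis
      using assms
      by (auto simp: weighted_log_mean_def weighted_geom_mean_def log_mean_def
          powr_add [symmetric] algebra_simps)
  next
    case 2
    define g d where "g = weighted_geom_mean v a b" and "d = ln a - ln b"
    have "d \<noteq> 0"
      using assms 2 by (simp add: d_def)
    have lna: "ln a - ln g = v * d" and lnb: "ln b - ln g = - (1 - v) * d"
      using assms by (simp_all add: g_def d_def ln_weighted_geom_mean algebra_simps)
    \<comment> \<open>Equality would make \<open>v * d\<close> or \<open>(1 - v) * d\<close> vanish.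
      This selects the quotient branch of \<open>log_mean\<close>.\<close>
    have "g \<noteq> a" "g \<noteq> b"
      using lna lnb \<open>d \<noteq> 0\<close> 2 by auto
    then have "log_mean g a = (a - g) / (v * d)" "log_mean g b = (b - g) / (- (1 - v) * d)"
      by (simp_all only: log_mean_def lna lnb if_False)
    moreover have "weighted_log_mean v a b =
        1 / d * ((1 - v) / v * (a - g) + v / (1 - v) * (g - b))"
      using 2 by (simp add: weighted_log_mean_def g_def d_def weighted_geom_mean_def)
    \<comment> \<open>The negative denominator is what reverses \<open>b - g\<close> into the
      \<open>g - b\<close> of the closed formula.\<close>
    moreover have "v * ((b - g) / (- (1 - v) * d)) = 1 / d * (v / (1 - v) * (g - b))"
      using 2 \<open>d \<noteq> 0\<close> by (simp add: divide_simps) (simp add: algebra_simps)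
    ultimately show ?thesis
      unfolding g_def [symmetric] by (simp add: distrib_left)
  qed
qed

lemma weighted_identric_mean_eq:
  assumes "a > 0" "b > 0" "0 \<le> v" "v \<le> 1"
  shows "weighted_identric_mean v a b =
    identric_mean (weighted_arith_mean v a b) a powr (1 - v)
    * identric_mean (weighted_arith_mean v a b) b powr v"
proof -
  consider "a = b" | "v = 0" "a \<noteq> b" | "v = 1" "a \<noteq> b" | "a \<noteq> b" "0 < v" "v < 1"
    using assms by linarith
  then show ?thesis
  proof cases
    case 1
    then have "weighted_arith_mean v a b = a"
      by (simp add: weighted_arith_mean_def algebra_simps)
    then show ?thesis
      using 1 assms
      by (simp add: weighted_identric_mean_def identric_mean_def powr_add [symmetric])
  next
    case 2
    \<comment> \<open>The factor with exponent \<open>0\<close> equals \<open>1\<close> only for a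
      nonzero base, hence the appeal to positivity; likewise for \<open>v = 1\<close>.\<close>
    then show ?thesis
      using assms identric_mean_pos [of a b]
      by (simp add: weighted_identric_mean_def weighted_arith_mean_def identric_mean_def [of a a])
  next
    case 3
    then show ?thesis
      using assms identric_mean_pos [of b a]
      by (simp add: weighted_identric_mean_def weighted_arith_mean_def identric_mean_def [of b b])
  next
    case 4
    define m where "m = weighted_arith_mean v a b"
    have "m > 0"
      using assms by (simp add: m_def weighted_arith_mean_pos)
    have ma: "a - m = - (v * (b - a))" and mb: "b - m = (1 - v) * (b - a)"
      using weighted_arith_mean_minus [of v a b] by (simp_all add: m_def algebra_simps)
    then have "m \<noteq> a" "m \<noteq> b"
      using 4 by auto
    then have "identric_mean m a powr (1 - v) * identric_mean m b powr v =
        exp ((1 - v) * ((a * ln a - m * ln m) / (- (v * (b - a))) - 1)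
           + v * ((b * ln b - m * ln m) / ((1 - v) * (b - a)) - 1))"
      using assms \<open>m > 0\<close> by (simp add: identric_mean_powr exp_add ma mb)
    moreover have "weighted_identric_mean v a b =
        exp (- 1 + (1 - 2 * v) * m / (v * (1 - v) * (b - a)) * ln m
          + 1 / (b - a) * (v * b / (1 - v) * ln b - (1 - v) * a / v * ln a))"
      using assms 4 \<open>m > 0\<close>
      by (simp add: weighted_identric_mean_def m_def [symmetric] powr_def exp_add exp_diff ln_div)
    \<comment> \<open>Replacing \<open>a * ln a\<close>, \<open>b * ln b\<close> and
      \<open>m * ln m\<close> by free variables leaves an identity of rational functions. The
      constant \<open>- 1\<close> survives because the weights sum to \<open>1\<close>.\<close>
    moreover have "(1 - v) * ((x - z) / (- (v * c)) - 1) + v * ((y - z) / ((1 - v) * c) - 1) =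
        - 1 + (1 - 2 * v) * z / (v * (1 - v) * c)
        + 1 / c * (v / (1 - v) * y - (1 - v) / v * x)" if "c \<noteq> 0" for x y z c
      using 4 that by (simp add: divide_simps) (simp add: algebra_simps)
    from this [of "b - a" "a * ln a" "m * ln m" "b * ln b"]
    have "(1 - v) * ((a * ln a - m * ln m) / (- (v * (b - a))) - 1)
           + v * ((b * ln b - m * ln m) / ((1 - v) * (b - a)) - 1) =
        - 1 + (1 - 2 * v) * m / (v * (1 - v) * (b - a)) * ln m
          + 1 / (b - a) * (v * b / (1 - v) * ln b - (1 - v) * a / v * ln a)"
      using 4 by (simp add: mult.assoc)
    ultimately show ?thesis
      unfolding m_def [symmetric] by simp
  qed
qed

theorem theorem2p1:
  fixes a b v :: real
  assumes "a > 0" and "b > 0" and "0 \<le> v" and "v \<le> 1"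
  shows "weighted_log_mean v a b =
           (1 - v) * log_mean (weighted_geom_mean v a b) a
           + v * log_mean (weighted_geom_mean v a b) b
       \<and> (1 - v) * log_mean (weighted_geom_mean v a b) a
           + v * log_mean (weighted_geom_mean v a b) b =
         weighted_arith_mean v (log_mean (weighted_geom_mean v a b) a)
                               (log_mean (weighted_geom_mean v a b) b)
       \<and> weighted_identric_mean v a b =
           identric_mean (weighted_arith_mean v a b) a powr (1 - v)
           * identric_mean (weighted_arith_mean v a b) b powr v
       \<and> identric_mean (weighted_arith_mean v a b) a powr (1 - v)
           * identric_mean (weighted_arith_mean v a b) b powr v =
         weighted_geom_mean v (identric_mean (weighted_arith_mean v a b) a)
                              (identric_mean (weighted_arith_mean v a b) b)"
  using weighted_log_mean_eq [OF assms] weighted_identric_mean_eq [OF assms]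
  by (simp add: weighted_arith_mean_def [of v "log_mean _ _"]
      weighted_geom_mean_def [of v "identric_mean _ _"])

end
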